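(* Let $\mathcal{A}=\bigcup_\alpha X_\alpha$ be a decomposing strong algebra, $\mathcal{A}=\mathcal{A}^+\oplus\mathcal{A}^-$, in which elements that have an inverse on one side are invertible, and let $a\in\mathcal{A}$. Let $P$ be the projection of $\mathcal{A}$ onto $\mathcal{A}^+$ parallel to $\mathcal{A}^-$ and $Q=I-P$. If there are $\alpha\in A$ and $\beta\ge h(\alpha)$ such that $$A_{\beta,\alpha}\|1-a\|_\alpha<\left(\max\{\|P\|^\beta_\beta,\|Q\|^\beta_\beta\}\right)^{-1},$$ then $a$ admits a canonical factorization $a=a_-a_+$, and the factors $a_+,a_-$ may be chosen as $a_+=x^{-1}$ and $a_-=y^{-1}$, where $x,y$ are the solutions of $$P(ax)+Q(x)=1,\qquad P(y)+Q(ya)=1,$$ respectively.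
   Context: Inductive limit of Banach spaces: a vector space $X$ with a family $\{X_\alpha:\alpha\in A\}$ of subspaces, $X_\alpha\ne X_\beta$ for $\alpha\neq\beta$, directed under inclusion, with $X=\bigcup_\alpha X_\alpha$; the index set $A$ is directed by $\alpha\le\beta$ iff $X_\alpha\subseteq X_\beta$. Each $X_\alpha$ is a Banach space with norm $\|\cdot\|_\alpha$, and whenever $\alpha\le\beta$ the topology induced by $\|\cdot\|_\beta$ on $X_\alpha$ is coarser than that induced by $\|\cdot\|_\alpha$. $X$ carries the inductive limit topology: the finest locally convex topology making all inclusions $X_\alpha\hookrightarrow X$ continuous. Strong algebra: an inductive limit $\mathcal{A}=\bigcup_{\alpha\in A} X_\alpha$ of Banach spaces which is also an (associative) algebra such that for any $\alpha\in A$ there exists $h(\alpha)\in A$ such that for any $\beta\ge h(\alpha)$ there is a positive constant $A_{\beta,\alpha}$ with $\|ab\|_\beta\le A_{\beta,\alpha}\|a\|_\alpha\|b\|_\beta$ and $\|ba\|_\beta\le A_{\beta,\alpha}\|a\|_\alpha\|b\|_\beta$ for every $a\in X_\alpha$, $b\in X_\beta$. The map $h$ and constants $A_{\beta,\alpha}$ are fixed. Writing $\|x\|_\alpha$ presupposes $x\in X_\alpha$. Decomposing strong algebra: a unital strong algebra $\mathcal{A}$ which is a direct sum $\mathcal{A}=\mathcal{A}^+\oplus\mathcal{A}^-$ of two closed subalgebras. Canonical factorization: $GL(\mathcal{A})$ denotes the invertible elements. An element $a\in GL(\mathcal{A})$ admits a canonical factorization if $a=a_-a_+$ where $a_-,a_+\in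 GL(\mathcal{A})$ satisfy $a_+-1,\ a_+^{-1}-1\in\mathcal{A}^+$ and $a_--1,\ a_-^{-1}-1\in\mathcal{A}^-$. For a linear map $T:\mathcal{A}\to\mathcal{A}$, $\|T\|^\alpha_\beta$ denotes the operator norm of $T|_{X_\alpha}:X_\alpha\to X_\beta$ if $T(X_\alpha)\subseteq X_\beta$ and this restriction is continuous, and $\|T\|^\alpha_\beta=\infty$ otherwise.
   Formalization: The formal theorem additionally assumes that 1−a lies in X_β (automatic if h(α)≥α or if 1∈X_β); without this the statement is false, e.g. in ℂ×ℂ with X_β=ℂ×0 and a=(1,0). *)

theory Defs
  imports "HOL-Analysis.Analysis"
begin

text \<open>
  The scalar field is any type of class \<open>real_normed_field\<close>; up to isometric isomorphism these are
  the real and the complex numbers.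
\<close>

section \<open>Norms on subspaces\<close>

text \<open>
  A norm on a subspace \<open>S\<close> is a total function \<open>N\<close>, only whose values on \<open>S\<close> matter. The guard makes
  the distance nonnegative and symmetric everywhere, as the locale \<open>Metric_space\<close> demands.
\<close>

definition norm_dist :: "'a::ab_group_add set \<Rightarrow> ('a \<Rightarrow> real) \<Rightarrow> 'a \<Rightarrow> 'a \<Rightarrow> real" where
  "norm_dist S N x y = (if x \<in> S \<and> y \<in> S then N (x - y) else 0)"

definition norm_topology :: "'a::ab_group_add set \<Rightarrow> ('a \<Rightarrow> real) \<Rightarrow> 'a topology" where
  "norm_topology S N = Metric_space.mtopology S (norm_dist S N)"

definition banach_subspace ::
  "('k::real_normed_field \<Rightarrow> 'a::ab_group_add \<Rightarrow> 'a) \<Rightarrow> 'a set \<Rightarrow> ('a \<Rightarrow> real) \<Rightarrow> bool" where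
  "banach_subspace scl S N \<longleftrightarrow>
     module.subspace scl S \<and>
     (\<forall>x\<in>S. 0 \<le> N x) \<and>
     (\<forall>x\<in>S. N x = 0 \<longleftrightarrow> x = 0) \<and>
     (\<forall>x\<in>S. \<forall>y\<in>S. N (x + y) \<le> N x + N y) \<and>
     (\<forall>c. \<forall>x\<in>S. N (scl c x) = norm c * N x) \<and>
     Metric_space.mcomplete S (norm_dist S N)"

text \<open>
  The operator norm \<open>\<parallel>T\<parallel>\<close> of \<open>T\<close> as a map from \<open>(S, N)\<close> to \<open>(S', N')\<close>, with value \<open>\<infinity>\<close> if \<open>T\<close> does
  not restrict to a continuous map between these spaces.
\<close>

definition op_norm ::
  "'a::ab_group_add set \<Rightarrow> ('a \<Rightarrow> real) \<Rightarrow> 'a set \<Rightarrow> ('a \<Rightarrow> real) \<Rightarrow> ('a \<Rightarrow> 'a) \<Rightarrow> ereal" where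
  "op_norm S N S' N' T =
     (if T ` S \<subseteq> S' \<and> continuous_map (norm_topology S N) (norm_topology S' N') T
      then (SUP x\<in>{x\<in>S. N x \<le> 1}. ereal (N' (T x))) else \<infinity>)"


section \<open>Inductive limits of Banach spaces\<close>

text \<open>Locally convex topologies are not required to be Hausdorff.\<close>

definition locally_convex_topology ::
  "('k::real_normed_field \<Rightarrow> 'a::ab_group_add \<Rightarrow> 'a) \<Rightarrow> 'a topology \<Rightarrow> bool" where
  "locally_convex_topology scl T \<longleftrightarrow>
     topspace T = UNIV \<and>
     continuous_map (prod_topology T T) T (\<lambda>(x, y). x + y) \<and>
     continuous_map (prod_topology euclidean T) T (\<lambda>(c, x). scl c x) \<and>
     (\<forall>U. openin T U \<and> 0 \<in> U \<longrightarrow>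
        (\<exists>V. openin T V \<and> 0 \<in> V \<and> V \<subseteq> U \<and>
             (\<forall>x\<in>V. \<forall>y\<in>V. \<forall>t::real. 0 \<le> t \<and> t \<le> 1 \<longrightarrow>
                scl (of_real (1 - t)) x + scl (of_real t) y \<in> V)))"

text \<open>
  The order on the index set \<open>I\<close> is \<open>\<alpha> \<le> \<beta> \<longleftrightarrow> X \<alpha> \<subseteq> X \<beta>\<close>, and is written out as the inclusion
  throughout.
\<close>

locale inductive_limit = vector_space scl
  for scl :: "'k::real_normed_field \<Rightarrow> 'a::ab_group_add \<Rightarrow> 'a" +
  fixes I :: "'i set"
    and X :: "'i \<Rightarrow> 'a set"
    and nrm :: "'i \<Rightarrow> 'a \<Rightarrow> real"
  assumes banach: "\<alpha> \<in> I \<Longrightarrow> banach_subspace scl (X \<alpha>) (nrm \<alpha>)"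
    and distinct: "inj_on X I"
    and directed: "\<lbrakk>\<alpha> \<in> I; \<beta> \<in> I\<rbrakk> \<Longrightarrow> \<exists>\<gamma>\<in>I. X \<alpha> \<subseteq> X \<gamma> \<and> X \<beta> \<subseteq> X \<gamma>"
    and union: "(\<Union>\<alpha>\<in>I. X \<alpha>) = UNIV"
    and coarser: "\<lbrakk>\<alpha> \<in> I; \<beta> \<in> I; X \<alpha> \<subseteq> X \<beta>; openin (norm_topology (X \<alpha>) (nrm \<beta>)) U\<rbrakk>
                  \<Longrightarrow> openin (norm_topology (X \<alpha>) (nrm \<alpha>)) U"

definition admissible_topology ::
  "('k::real_normed_field \<Rightarrow> 'a::ab_group_add \<Rightarrow> 'a) \<Rightarrow> 'i set \<Rightarrow> ('i \<Rightarrow> 'a set) \<Rightarrow>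
   ('i \<Rightarrow> 'a \<Rightarrow> real) \<Rightarrow> 'a topology \<Rightarrow> bool" where
  "admissible_topology scl I X nrm T \<longleftrightarrow>
     locally_convex_topology scl T \<and>
     (\<forall>\<alpha>\<in>I. continuous_map (norm_topology (X \<alpha>) (nrm \<alpha>)) T (\<lambda>x. x))"

text \<open>
  The inductive limit topology is defined as the supremum of the admissible topologies; the lemmas
  \<open>admissible_inductive_limit_topology\<close> and \<open>inductive_limit_topology_finest\<close> show that it is
  the finest one among them.
\<close>

definition inductive_limit_topology ::
  "('k::real_normed_field \<Rightarrow> 'a::ab_group_add \<Rightarrow> 'a) \<Rightarrow> 'i set \<Rightarrow> ('i \<Rightarrow> 'a set) \<Rightarrow>
   ('i \<Rightarrow> 'a \<Rightarrow> real) \<Rightarrow> 'a topology" where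
  "inductive_limit_topology scl I X nrm =
     topology_generated_by {U. \<exists>T. admissible_topology scl I X nrm T \<and> openin T U}"

lemma inductive_limit_topology_finest:
  assumes "admissible_topology scl I X nrm T" "openin T U"
  shows "openin (inductive_limit_topology scl I X nrm) U"
  unfolding inductive_limit_topology_def using assms
  by (intro topology_generated_by_Basis) blast

lemma admissible_indiscrete:
  assumes "vector_space (scl :: 'k::real_normed_field \<Rightarrow> 'a::ab_group_add \<Rightarrow> 'a)"
  shows "admissible_topology scl I X nrm (topology_generated_by {UNIV})"
proof -
  have c: "continuous_map S (topology_generated_by {UNIV}) f" for S :: "'z topology" and f :: "'z \<Rightarrow> 'a"
    by (rule continuous_on_generated_topo) auto
  have "U = {} \<or> U = UNIV" if "generate_topology_on {UNIV :: 'a set} U" for U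
    using that by (induction) auto
  then show ?thesis
    unfolding admissible_topology_def locally_convex_topology_def
    by (auto simp: c openin_topology_generated_by_iff intro!: exI[of _ UNIV] generate_topology_on.Basis)
qed

lemma admissible_inductive_limit_topology:
  fixes scl :: "'k::real_normed_field \<Rightarrow> 'a::ab_group_add \<Rightarrow> 'a"
  assumes "vector_space scl"
  shows "admissible_topology scl I X nrm (inductive_limit_topology scl I X nrm)"
proof -
  define T0 where "T0 = inductive_limit_topology scl I X nrm"
  let ?S = "{U. \<exists>T. admissible_topology scl I X nrm T \<and> openin T U}"
  have T0: "T0 = topology_generated_by ?S"
    by (simp add: T0_def inductive_limit_topology_def)
  have fin: "openin T0 U" if "admissible_topology scl I X nrm T" "openin T U" for T U
    using inductive_limit_topology_finest[OF that] by (simp add: T0_def)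
  have U: "UNIV \<in> ?S"
    using admissible_indiscrete[OF assms] by (auto intro!: exI topology_generated_by_Basis)
  have ts: "topspace T0 = UNIV" using U unfolding T0 topology_generated_by_topspace by blast
  have top: "topspace T = UNIV" if "admissible_topology scl I X nrm T" for T
    using that by (simp add: admissible_topology_def locally_convex_topology_def)
  have gen: "continuous_map S T0 f"
    if "\<And>T. admissible_topology scl I X nrm T \<Longrightarrow> continuous_map S T f"
    for S :: "'z topology" and f
    unfolding T0
  proof (rule continuous_on_generated_topo)
    fix U assume "U \<in> ?S"
    then obtain T where T: "admissible_topology scl I X nrm T" "openin T U" by blast
    from that[OF T(1)] T(2) show "openin S (f -` U \<inter> topspace S)"
      by (simp add: continuous_map_alt)
  qed (use U in blast)
  have idc: "continuous_map T0 T (\<lambda>x. x)" if "admissible_topology scl I X nrm T" for T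
    using fin[OF that] top[OF that] ts by (simp add: continuous_map_def)
  have add: "continuous_map (prod_topology T0 T0) T0 (\<lambda>(x, y). x + y)"
  proof (rule gen)
    fix T assume T: "admissible_topology scl I X nrm T"
    have "continuous_map (prod_topology T0 T0) (prod_topology T T) (\<lambda>(x, y). (x, y))"
      using idc[OF T] continuous_map_prod_top[of T0 T0 T T "\<lambda>x. x" "\<lambda>x. x"] by blast
    moreover have "continuous_map (prod_topology T T) T (\<lambda>(x, y). x + y)"
      using T by (simp add: admissible_topology_def locally_convex_topology_def)
    ultimately show "continuous_map (prod_topology T0 T0) T (\<lambda>(x, y). x + y)"
      using continuous_map_compose by (fastforce simp: o_def case_prod_unfold)
  qed
  have scm: "continuous_map (prod_topology euclidean T0) T0 (\<lambda>(c, x). scl c x)"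
  proof (rule gen)
    fix T assume T: "admissible_topology scl I X nrm T"
    have "continuous_map (prod_topology euclidean T0) (prod_topology euclidean T)
            (\<lambda>(c::'k, y). (c, y))"
      using idc[OF T] continuous_map_prod_top[of "euclidean :: 'k topology" T0 euclidean T "\<lambda>c. c" "\<lambda>x. x"]
        continuous_map_id[unfolded id_def, of "euclidean :: 'k topology"] by blast
    moreover have "continuous_map (prod_topology euclidean T) T (\<lambda>(c, x). scl c x)"
      using T by (simp add: admissible_topology_def locally_convex_topology_def)
    ultimately show "continuous_map (prod_topology euclidean T0) T (\<lambda>(c, x). scl c x)"
      using continuous_map_compose by (fastforce simp: o_def case_prod_unfold)
  qed
  define cvx where "cvx V \<longleftrightarrow> (\<forall>x\<in>V. \<forall>y\<in>V. \<forall>t::real. 0 \<le> t \<and> t \<le> 1 \<longrightarrow>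
                scl (of_real (1 - t)) x + scl (of_real t) y \<in> V)" for V
  have base: "0 \<in> U \<longrightarrow> (\<exists>V. openin T0 V \<and> 0 \<in> V \<and> V \<subseteq> U \<and> cvx V)"
    if "generate_topology_on ?S U" for U
    using that
  proof (induction)
    case Empty then show ?case by simp
  next
    case (Int a b)
    show ?case
    proof
      assume "0 \<in> a \<inter> b"
      with Int obtain V W where "openin T0 V" "0 \<in> V" "V \<subseteq> a" "cvx V"
        "openin T0 W" "0 \<in> W" "W \<subseteq> b" "cvx W" by blast
      then show "\<exists>V. openin T0 V \<and> 0 \<in> V \<and> V \<subseteq> a \<inter> b \<and> cvx V"
        by (intro exI[of _ "V \<inter> W"]) (auto simp: cvx_def)
    qed
  next
    case (UN K) then show ?case by (meson UnionE Union_upper order_trans)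
  next
    case (Basis s)
    then obtain T where T: "admissible_topology scl I X nrm T" "openin T s" by blast
    then show ?case using fin[OF T(1)]
      unfolding admissible_topology_def locally_convex_topology_def cvx_def[symmetric] by meson
  qed
  have incl: "continuous_map (norm_topology (X \<alpha>) (nrm \<alpha>)) T0 (\<lambda>x. x)" if "\<alpha> \<in> I" for \<alpha>
    using that by (intro gen) (auto simp: admissible_topology_def)
  have "locally_convex_topology scl T0"
    unfolding locally_convex_topology_def cvx_def[symmetric]
    using ts add scm base by (simp add: T0 openin_topology_generated_by_iff)
  then show ?thesis using incl unfolding admissible_topology_def T0_def by blast
qed


section \<open>Strong algebras\<close>

text \<open>The constant \<open>C \<beta> \<alpha>\<close> stands for \<open>A\<^bsub>\<beta>,\<alpha>\<^esub>\<close>.\<close>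

locale strong_algebra = inductive_limit scl I X nrm
  for scl :: "'k::real_normed_field \<Rightarrow> 'a::ring \<Rightarrow> 'a"
    and I :: "'i set"
    and X :: "'i \<Rightarrow> 'a set"
    and nrm :: "'i \<Rightarrow> 'a \<Rightarrow> real" +
  fixes h :: "'i \<Rightarrow> 'i"
    and C :: "'i \<Rightarrow> 'i \<Rightarrow> real"
  assumes scale_mult_left: "scl c x * y = scl c (x * y)"
    and scale_mult_right: "x * scl c y = scl c (x * y)"
    and h_in: "\<alpha> \<in> I \<Longrightarrow> h \<alpha> \<in> I"
    and C_pos: "\<lbrakk>\<alpha> \<in> I; \<beta> \<in> I; X (h \<alpha>) \<subseteq> X \<beta>\<rbrakk> \<Longrightarrow> 0 < C \<beta> \<alpha>"
    and strong_left: "\<lbrakk>\<alpha> \<in> I; \<beta> \<in> I; X (h \<alpha>) \<subseteq> X \<beta>; a \<in> X \<alpha>; b \<in> X \<beta>\<rbrakk>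
       \<Longrightarrow> a * b \<in> X \<beta> \<and> nrm \<beta> (a * b) \<le> C \<beta> \<alpha> * nrm \<alpha> a * nrm \<beta> b"
    and strong_right: "\<lbrakk>\<alpha> \<in> I; \<beta> \<in> I; X (h \<alpha>) \<subseteq> X \<beta>; a \<in> X \<alpha>; b \<in> X \<beta>\<rbrakk>
       \<Longrightarrow> b * a \<in> X \<beta> \<and> nrm \<beta> (b * a) \<le> C \<beta> \<alpha> * nrm \<alpha> a * nrm \<beta> b"

text \<open>
  The sort \<open>{ring, monoid_mult}\<close> is that of associative unital rings; unlike \<open>ring_1\<close> it does not
  impose \<open>0 \<noteq> 1\<close>. Subalgebras need not contain the unit.
\<close>

locale decomposing_strong_algebra = strong_algebra scl I X nrm h C
  for scl :: "'k::real_normed_field \<Rightarrow> 'a::{ring, monoid_mult} \<Rightarrow> 'a"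
    and I :: "'i set"
    and X :: "'i \<Rightarrow> 'a set"
    and nrm :: "'i \<Rightarrow> 'a \<Rightarrow> real"
    and h :: "'i \<Rightarrow> 'i"
    and C :: "'i \<Rightarrow> 'i \<Rightarrow> real" +
  fixes Ap Am :: "'a set"
  assumes subspace_Ap: "subspace Ap"
    and subspace_Am: "subspace Am"
    and mult_Ap: "\<lbrakk>x \<in> Ap; y \<in> Ap\<rbrakk> \<Longrightarrow> x * y \<in> Ap"
    and mult_Am: "\<lbrakk>x \<in> Am; y \<in> Am\<rbrakk> \<Longrightarrow> x * y \<in> Am"
    and closed_Ap: "closedin (inductive_limit_topology scl I X nrm) Ap"
    and closed_Am: "closedin (inductive_limit_topology scl I X nrm) Am"
    and sum_eq: "\<exists>p\<in>Ap. \<exists>q\<in>Am. x = p + q"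
    and int_eq: "Ap \<inter> Am = {0}"

definition proj_along :: "'a::ab_group_add set \<Rightarrow> 'a set \<Rightarrow> 'a \<Rightarrow> 'a" where
  "proj_along Ap Am x = (THE p. p \<in> Ap \<and> x - p \<in> Am)"


section \<open>Canonical factorizations\<close>

definition GL :: "'a::monoid_mult set" where
  "GL = {a. \<exists>b. a * b = 1 \<and> b * a = 1}"

definition inv_elem :: "'a::monoid_mult \<Rightarrow> 'a" where
  "inv_elem a = (THE b. a * b = 1 \<and> b * a = 1)"

definition canonical_factorization ::
  "'a::{ring, monoid_mult} set \<Rightarrow> 'a set \<Rightarrow> 'a \<Rightarrow> 'a \<Rightarrow> 'a \<Rightarrow> bool" where
  "canonical_factorization Ap Am a am ap \<longleftrightarrow>
     a \<in> GL \<and> am \<in> GL \<and> ap \<in> GL \<and> a = am * ap \<and>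
     ap - 1 \<in> Ap \<and> inv_elem ap - 1 \<in> Ap \<and>
     am - 1 \<in> Am \<and> inv_elem am - 1 \<in> Am"

definition admits_canonical_factorization ::
  "'a::{ring, monoid_mult} set \<Rightarrow> 'a set \<Rightarrow> 'a \<Rightarrow> bool" where
  "admits_canonical_factorization Ap Am a \<longleftrightarrow> (\<exists>am ap. canonical_factorization Ap Am a am ap)"

end

theory Submission
  imports Defs
begin

text \<open>
  Put \<open>b = 1 - a\<close>. For the decomposition \<open>\<A> = \<A>\<^sup>+ \<oplus> \<A>\<^sup>-\<close>, an equation \<open>P u + Q v = 1\<close> says exactly that
  \<open>v - 1 \<in> \<A>\<^sup>+\<close> and \<open>u - 1 \<in> \<A>\<^sup>-\<close> (lemma \<open>proj_plus_compl_eq_iff\<close>). Hence \<open>x\<close> solves the first equation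
  iff \<open>x - 1 \<in> \<A>\<^sup>+\<close> and \<open>a x - 1 \<in> \<A>\<^sup>-\<close>, and \<open>y\<close> solves the second one iff \<open>y a - 1 \<in> \<A>\<^sup>+\<close> and
  \<open>y - 1 \<in> \<A>\<^sup>-\<close>.

  Algebra: for solutions \<open>x\<close> and \<open>y\<close>, the element \<open>y a x\<close> lies in \<open>1 + \<A>\<^sup>+\<close>, being \<open>(y a) x\<close>, and in
  \<open>1 + \<A>\<^sup>-\<close>, being \<open>y (a x)\<close>. So \<open>y a x = 1\<close> (lemma \<open>mult_of_solutions_eq_one\<close>). One-sided inverses being inverses, \<open>x\<^sup>-\<^sup>1 = y a\<close> and
  \<open>y\<^sup>-\<^sup>1 = a x\<close>; the memberships above are then those that a canonical factorization
  \<open>a = y\<^sup>-\<^sup>1 x\<^sup>-\<^sup>1\<close> requires (lemma \<open>canonical_factorization_of_solutions\<close>). This also shows that a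
  solution of either equation determines the solution of the other one. Uniqueness in all of \<open>\<A>\<close> thus
  follows from existence, although the norms of \<open>P\<close> and \<open>Q\<close> are controlled on \<open>X\<^sub>\<beta>\<close> only.

  Analysis: the equations amount to \<open>x = 1 + P (b x)\<close> and \<open>y = 1 + Q (y b)\<close>. The unit need not lie in
  \<open>X\<^sub>\<beta>\<close>, so one solves for \<open>z = x - 1\<close>, that is \<open>z = P b + P (b z)\<close>. Here \<open>P b \<in> X\<^sub>\<beta>\<close>, and
  \<open>z \<mapsto> P (b z)\<close> has norm at most \<open>\<parallel>P\<parallel> A\<^bsub>\<beta>,\<alpha>\<^esub> \<parallel>b\<parallel>\<^sub>\<alpha> < 1\<close> on the Banach space \<open>X\<^sub>\<beta>\<close>, so the
  contraction principle applies (lemma \<open>banach_subspace_affine_fixed_point\<close>).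
\<close>

section \<open>Projections along a complementary subspace\<close>

locale complementary_subspaces = vector_space scl
  for scl :: "'k::field \<Rightarrow> 'a::ab_group_add \<Rightarrow> 'a" +
  fixes U V :: "'a set"
  assumes subspace_U: "subspace U"
    and subspace_V: "subspace V"
    and decomposition: "\<exists>p\<in>U. \<exists>q\<in>V. x = p + q"
    and disjoint: "U \<inter> V = {0}"
begin

abbreviation proj :: "'a \<Rightarrow> 'a" where
  "proj \<equiv> proj_along U V"

abbreviation compl :: "'a \<Rightarrow> 'a" where
  "compl x \<equiv> x - proj x"

lemma both_imp_zero: "x \<in> U \<Longrightarrow> x \<in> V \<Longrightarrow> x = 0"
  using disjoint by blast

lemma proj_eqI:
  assumes "p \<in> U" "x - p \<in> V"
  shows "proj x = p"
  unfolding proj_along_def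
proof (rule the_equality)
  fix p' assume p': "p' \<in> U \<and> x - p' \<in> V"
  have "p' - p \<in> U"
    using p' assms subspace_U by (simp add: subspace_diff)
  moreover have "p' - p \<in> V"
    using subspace_diff[OF subspace_V assms(2), of "x - p'"] p' by simp
  ultimately show "p' = p"
    using both_imp_zero by fastforce
qed (use assms in blast)

lemma proj_in: "proj x \<in> U" and compl_in: "compl x \<in> V"
proof -
  obtain p q where "p \<in> U" "q \<in> V" "x = p + q"
    using decomposition by blast
  moreover from this have "proj x = p"
    by (intro proj_eqI) auto
  ultimately show "proj x \<in> U" "compl x \<in> V"
    by auto
qed

lemma proj_add: "proj (x + y) = proj x + proj y"
proof (rule proj_eqI)
  have "compl x + compl y \<in> V"
    by (intro subspace_add subspace_V compl_in)
  then show "x + y - (proj x + proj y) \<in> V"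
    by (simp add: algebra_simps)
qed (intro subspace_add subspace_U proj_in)

lemma proj_scale: "proj (scl c x) = scl c (proj x)"
proof (rule proj_eqI)
  have "scl c (compl x) \<in> V"
    by (intro subspace_scale subspace_V compl_in)
  then show "scl c x - scl c (proj x) \<in> V"
    by (simp add: scale_right_diff_distrib)
qed (intro subspace_scale subspace_U proj_in)

lemma module_hom_proj: "module_hom scl scl proj"
  by unfold_locales (simp_all add: proj_add proj_scale)

lemma module_hom_compl: "module_hom scl scl (\<lambda>x. compl x)"
  by unfold_locales (simp_all add: proj_add proj_scale scale_right_diff_distrib)

text \<open>
  Modulo \<open>U\<close> only the complementary parts of \<open>v\<close> and \<open>e\<close> count, and modulo \<open>V\<close> only the projections
  of \<open>u\<close> and \<open>e\<close>; one equation in the direct sum is therefore a pair of independent congruences.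
\<close>

lemma proj_plus_compl_eq_iff:
  "proj u + compl v = e \<longleftrightarrow> v - e \<in> U \<and> u - e \<in> V"
proof
  assume e: "proj u + compl v = e"
  have "proj v - proj u \<in> U" and "compl u - compl v \<in> V"
    by (intro subspace_diff subspace_U subspace_V proj_in compl_in)+
  moreover have "v - e = proj v - proj u" "u - e = compl u - compl v"
    unfolding e[symmetric] by (simp_all add: algebra_simps)
  ultimately show "v - e \<in> U \<and> u - e \<in> V"
    by metis
next
  assume *: "v - e \<in> U \<and> u - e \<in> V"
  have "proj (v - e) = v - e" and "proj (u - e) = 0"
    using * by (auto intro!: proj_eqI simp: subspace_0 subspace_U subspace_V)
  moreover have "proj v = proj (v - e) + proj e" "proj u = proj (u - e) + proj e"
    by (simp_all flip: proj_add)
  ultimately show "proj u + compl v = e"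
    by simp
qed

end


section \<open>Bounded maps and contractions on Banach subspaces\<close>

lemma banach_subspaceD:
  assumes "banach_subspace scl S N"
  shows "module.subspace scl S"
    and "x \<in> S \<Longrightarrow> 0 \<le> N x"
    and "x \<in> S \<Longrightarrow> N x = 0 \<longleftrightarrow> x = 0"
    and "x \<in> S \<Longrightarrow> y \<in> S \<Longrightarrow> N (x + y) \<le> N x + N y"
    and "x \<in> S \<Longrightarrow> N (scl c x) = norm c * N x"
    and "Metric_space.mcomplete S (norm_dist S N)"
  using assms unfolding banach_subspace_def by auto

lemma Metric_space_norm_dist:
  assumes "vector_space scl" and "banach_subspace scl S N"
  shows "Metric_space S (norm_dist S N)"
proof -
  interpret vector_space scl by fact
  note B = banach_subspaceD[OF assms(2)]
  note diff = subspace_diff[OF B(1)]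
  have sym: "N (x - y) = N (y - x)" if "x \<in> S" "y \<in> S" for x y
  proof -
    have "N (scl (- 1) (y - x)) = norm (- 1 :: 'a) * N (y - x)"
      using diff that by (intro B(5))
    then show ?thesis
      by simp
  qed
  show ?thesis
  proof
    fix x y z assume "x \<in> S" "y \<in> S" "z \<in> S"
    then have "N (x - y + (y - z)) \<le> N (x - y) + N (y - z)"
      by (intro B(4) diff)
    then show "norm_dist S N x z \<le> norm_dist S N x y + norm_dist S N y z"
      using \<open>x \<in> S\<close> \<open>y \<in> S\<close> \<open>z \<in> S\<close> by (simp add: norm_dist_def)
  next
    fix x y assume "x \<in> S" "y \<in> S"
    then have "N (x - y) = 0 \<longleftrightarrow> x - y = 0"
      by (intro B(3) diff)
    then show "norm_dist S N x y = 0 \<longleftrightarrow> x = y"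
      using \<open>x \<in> S\<close> \<open>y \<in> S\<close> by (simp add: norm_dist_def)
  qed (use B(2) diff sym in \<open>auto simp: norm_dist_def\<close>)
qed

lemma banach_subspace_affine_fixed_point:
  assumes vs: "vector_space scl" and B: "banach_subspace scl S N"
    and T: "Modules.additive T"
    and bound: "\<And>x. x \<in> S \<Longrightarrow> T x \<in> S \<and> N (T x) \<le> k * N x"
    and "k < 1" and c: "c \<in> S"
  shows "\<exists>z\<in>S. z = c + T z"
proof -
  interpret vector_space scl by fact
  interpret T: Modules.additive T by fact
  interpret Metric_space S "norm_dist S N"
    using vs B by (rule Metric_space_norm_dist)
  note S = banach_subspaceD(1)[OF B]
  have maps: "c + T z \<in> S" if "z \<in> S" for z
    using that bound c S by (simp add: subspace_add)
  show ?thesis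
  proof (rule Banach_fixedpoint_thm)
    show "mcomplete"
      using B by (rule banach_subspaceD)
    show "S \<noteq> {}" "k < 1"
      using c \<open>k < 1\<close> by auto
    show "(\<lambda>z. c + T z) \<in> S \<rightarrow> S"
      using maps by blast
    fix x y assume "x \<in> S" "y \<in> S"
    then show "norm_dist S N (c + T x) (c + T y) \<le> k * norm_dist S N x y"
      using maps bound[of "x - y"] S by (simp add: norm_dist_def subspace_diff T.diff)
  next
    fix z assume "z \<in> S" "c + T z = z"
    then show ?thesis
      by metis
  qed
qed

lemma op_norm_le_imp_bound:
  assumes S: "banach_subspace scl S N" and S': "banach_subspace scl S' N'"
    and T: "module_hom scl scl T"
    and le: "op_norm S N S' N' T \<le> ereal M"
    and x: "x \<in> S"
  shows "T x \<in> S' \<and> N' (T x) \<le> M * N x"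
proof -
  interpret T: module_hom scl scl T by fact
  note B = banach_subspaceD[OF S] and B' = banach_subspaceD[OF S']
  have T_in: "T y \<in> S'" if "y \<in> S" for y
    using le that by (auto simp: op_norm_def split: if_splits)
  have unit: "N' (T y) \<le> M" if "y \<in> S" "N y \<le> 1" for y
  proof -
    have "ereal (N' (T y)) \<le> (SUP x\<in>{x\<in>S. N x \<le> 1}. ereal (N' (T x)))"
      using that by (intro SUP_upper) simp
    also have "\<dots> \<le> ereal M"
      using le by (auto simp: op_norm_def split: if_splits)
    finally show ?thesis
      by simp
  qed
  show ?thesis
  proof (cases "x = 0")
    case True
    have "N 0 = 0" "N' 0 = 0"
      by (simp_all add: B(1,3) B'(1,3) T.m1.subspace_0)
    then show ?thesis
      using True T_in[OF x] T.zero by simp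
  next
    case False
    then have pos: "N x > 0"
      using B(2,3)[OF x] by simp
    let ?c = "of_real (inverse (N x))"
    have "scl ?c x \<in> S"
      using B(1) x by (rule T.m1.subspace_scale)
    moreover have "N (scl ?c x) = 1"
      using B(5)[OF x] pos by (simp add: norm_inverse)
    ultimately have "N' (T (scl ?c x)) \<le> M"
      using unit by simp
    moreover have "N' (T (scl ?c x)) = inverse (N x) * N' (T x)"
      using B'(5)[OF T_in[OF x]] pos by (simp add: T.scale norm_inverse)
    ultimately have "inverse (N x) * N' (T x) \<le> M"
      by simp
    then show ?thesis
      using T_in[OF x] pos by (simp add: field_simps)
  qed
qed

text \<open>
  The strict inequality excludes \<open>m = \<infinity>\<close>, since \<open>inverse \<infinity> = 0 \<le> c\<close>. If \<open>m = 0\<close>, then \<open>inverse m = \<infinity>\<close>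
  puts no bound on \<open>c\<close>, but \<open>k = 0\<close> will do.
\<close>

lemma op_norm_less_inverse_imp_bound:
  assumes S: "banach_subspace scl S N" and S': "banach_subspace scl S' N'"
    and T: "module_hom scl scl T"
    and le: "op_norm S N S' N' T \<le> m"
    and "0 \<le> c" and less: "ereal c < inverse m"
  obtains k where "0 \<le> k" "c * k < 1"
    "\<And>x. x \<in> S \<Longrightarrow> T x \<in> S' \<and> N' (T x) \<le> k * N x"
proof -
  interpret T: module_hom scl scl T by fact
  note B = banach_subspaceD[OF S] and B' = banach_subspaceD[OF S']
  have zero: "0 \<in> S" "N 0 = 0" "N' 0 = 0"
    by (simp_all add: B(1,3) B'(1,3) T.m1.subspace_0)
  have "0 \<le> op_norm S N S' N' T"
    unfolding op_norm_def using zero by (auto intro!: SUP_upper2[of 0] simp: T.zero)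
  then have "0 \<le> m"
    using le by (rule order_trans)
  moreover have "m \<noteq> \<infinity>"
    using less \<open>0 \<le> c\<close> by auto
  ultimately obtain k where k: "m = ereal k" "0 \<le> k"
    by (cases m) auto
  have "c * k < 1"
    using less k by (cases "k = 0") (auto simp: field_simps)
  then show ?thesis
    using that k op_norm_le_imp_bound[OF S S' T] le by blast
qed


section \<open>Solving the two equations\<close>

sublocale decomposing_strong_algebra \<subseteq> complementary_subspaces scl Ap Am
  by unfold_locales (use subspace_Ap subspace_Am sum_eq int_eq in auto)

context decomposing_strong_algebra
begin

text \<open>
  Both multiplications, \<open>z \<mapsto> b * z\<close> and \<open>z \<mapsto> z * b\<close>, and both projections are instances of \<open>L\<close> and
  \<open>T\<close>.
\<close>

lemma fixed_point_of_bounded_map_after_multiplication: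
  assumes "\<alpha> \<in> I" "\<beta> \<in> I" "X (h \<alpha>) \<subseteq> X \<beta>" and b: "b \<in> X \<alpha>" "b \<in> X \<beta>"
    and L: "Modules.additive L"
      "\<And>z. z \<in> X \<beta> \<Longrightarrow> L z \<in> X \<beta> \<and> nrm \<beta> (L z) \<le> C \<beta> \<alpha> * nrm \<alpha> b * nrm \<beta> z"
    and T: "module_hom scl scl T"
    and le: "op_norm (X \<beta>) (nrm \<beta>) (X \<beta>) (nrm \<beta>) T \<le> m"
    and less: "ereal (C \<beta> \<alpha> * nrm \<alpha> b) < inverse m"
  obtains z where "z = T (b + L z)"
proof -
  interpret L: Modules.additive L by fact
  interpret T: module_hom scl scl T by fact
  have "0 \<le> nrm \<alpha> b"
    using banach_subspaceD(2)[OF banach[OF \<open>\<alpha> \<in> I\<close>]] b by blast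
  then have nonneg: "0 \<le> C \<beta> \<alpha> * nrm \<alpha> b"
    using C_pos[of \<alpha> \<beta>] assms(1-3) by simp
  note B = banach[OF \<open>\<beta> \<in> I\<close>]
  obtain k where k: "0 \<le> k" "C \<beta> \<alpha> * nrm \<alpha> b * k < 1"
    "\<And>z. z \<in> X \<beta> \<Longrightarrow> T z \<in> X \<beta> \<and> nrm \<beta> (T z) \<le> k * nrm \<beta> z"
    using op_norm_less_inverse_imp_bound[OF B B T le nonneg less] by blast
  have "\<exists>z\<in>X \<beta>. z = T b + T (L z)"
  proof (rule banach_subspace_affine_fixed_point[OF vector_space_axioms B _ _ k(2)])
    show "Modules.additive (\<lambda>z. T (L z))"
      by unfold_locales (simp add: L.add T.add)
    show "T b \<in> X \<beta>"
      using k(3) b by blast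
    fix z assume "z \<in> X \<beta>"
    then have "T (L z) \<in> X \<beta> \<and> nrm \<beta> (T (L z)) \<le> k * nrm \<beta> (L z)"
      using k(3) L(2) by blast
    moreover have "k * nrm \<beta> (L z) \<le> k * (C \<beta> \<alpha> * nrm \<alpha> b * nrm \<beta> z)"
      using L(2) \<open>z \<in> X \<beta>\<close> k(1) by (intro mult_left_mono) auto
    ultimately show "T (L z) \<in> X \<beta> \<and> nrm \<beta> (T (L z)) \<le> C \<beta> \<alpha> * nrm \<alpha> b * k * nrm \<beta> z"
      by (simp add: mult_ac)
  qed
  then show ?thesis
    using that T.add by metis
qed

text \<open>
  The fixed point \<open>z = P (b (1 + z))\<close> lies in \<open>\<A>\<^sup>+\<close>, and \<open>a (1 + z) - 1 = z - b (1 + z)\<close> is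
  \<open>- Q (b (1 + z))\<close>, an element of \<open>\<A>\<^sup>-\<close>.
\<close>

lemma left_equation_solvable:
  assumes "\<alpha> \<in> I" "\<beta> \<in> I" "X (h \<alpha>) \<subseteq> X \<beta>" "1 - a \<in> X \<alpha>" "1 - a \<in> X \<beta>"
    and "op_norm (X \<beta>) (nrm \<beta>) (X \<beta>) (nrm \<beta>) proj \<le> m"
    and "ereal (C \<beta> \<alpha> * nrm \<alpha> (1 - a)) < inverse m"
  shows "\<exists>x. proj (a * x) + compl x = 1"
proof -
  let ?b = "1 - a"
  have "Modules.additive (\<lambda>z. ?b * z)"
    by unfold_locales (simp add: distrib_left)
  moreover have "?b * z \<in> X \<beta> \<and> nrm \<beta> (?b * z) \<le> C \<beta> \<alpha> * nrm \<alpha> ?b * nrm \<beta> z"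
    if "z \<in> X \<beta>" for z
    using strong_left assms(1-4) that by blast
  ultimately obtain z where z: "z = proj (?b + ?b * z)"
    using fixed_point_of_bounded_map_after_multiplication[OF assms(1-5) _ _ module_hom_proj assms(6,7)]
    by blast
  have "z \<in> Ap"
    using z proj_in by metis
  moreover have "- compl (?b + ?b * z) \<in> Am"
    by (intro subspace_neg subspace_V compl_in)
  then have "a * (1 + z) - 1 \<in> Am"
    using z by (simp add: algebra_simps)
  ultimately show ?thesis
    by (intro exI[of _ "1 + z"]) (simp add: proj_plus_compl_eq_iff)
qed

lemma right_equation_solvable:
  assumes "\<alpha> \<in> I" "\<beta> \<in> I" "X (h \<alpha>) \<subseteq> X \<beta>" "1 - a \<in> X \<alpha>" "1 - a \<in> X \<beta>"
    and "op_norm (X \<beta>) (nrm \<beta>) (X \<beta>) (nrm \<beta>) (\<lambda>x. compl x) \<le> m"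
    and "ereal (C \<beta> \<alpha> * nrm \<alpha> (1 - a)) < inverse m"
  shows "\<exists>y. proj y + compl (y * a) = 1"
proof -
  let ?b = "1 - a"
  have "Modules.additive (\<lambda>z. z * ?b)"
    by unfold_locales (simp add: distrib_right)
  moreover have "z * ?b \<in> X \<beta> \<and> nrm \<beta> (z * ?b) \<le> C \<beta> \<alpha> * nrm \<alpha> ?b * nrm \<beta> z"
    if "z \<in> X \<beta>" for z
    using strong_right assms(1-4) that by blast
  ultimately obtain z where z: "z = compl (?b + z * ?b)"
    using fixed_point_of_bounded_map_after_multiplication[OF assms(1-5) _ _ module_hom_compl assms(6,7)]
    by blast
  have "z \<in> Am"
    using z compl_in by metis
  moreover have "(1 + z) * a - 1 = - proj (?b + z * ?b)"
    using z by (simp add: algebra_simps)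
  then have "(1 + z) * a - 1 \<in> Ap"
    using subspace_neg[OF subspace_U proj_in] by simp
  ultimately show ?thesis
    by (intro exI[of _ "1 + z"]) (simp add: proj_plus_compl_eq_iff)
qed

end


section \<open>From the solutions to the factorization\<close>

lemma inv_elem_eqI:
  assumes "u * v = 1" "v * u = 1"
  shows "inv_elem u = v"
  unfolding inv_elem_def
proof (rule the_equality)
  fix w assume "u * w = 1 \<and> w * u = 1"
  then show "w = v"
    using assms by (metis mult.assoc mult_1_left mult_1_right)
qed (use assms in blast)

lemma GL_right_inverse_commute:
  assumes "u \<in> GL" "u * v = 1"
  shows "v * u = 1"
proof -
  obtain w where "w * u = 1"
    using assms(1) by (auto simp: GL_def)
  then show ?thesis
    using assms(2) by (metis mult.assoc mult_1_left mult_1_right)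
qed

context decomposing_strong_algebra
begin

lemma mult_of_solutions_eq_one:
  assumes x: "proj (a * x) + compl x = 1" and y: "proj y + compl (y * a) = 1"
  shows "y * a * x = 1"
proof -
  \<comment> \<open>\<open>1 + W\<close> is closed under products, whether or not \<open>W\<close> contains \<open>1\<close>.\<close>
  have one: "u * v - 1 \<in> W"
    if "subspace W" "\<And>p q. p \<in> W \<Longrightarrow> q \<in> W \<Longrightarrow> p * q \<in> W" "u - 1 \<in> W" "v - 1 \<in> W" for u v W
  proof -
    have "(u - 1) * (v - 1) + ((u - 1) + (v - 1)) \<in> W"
      using that by (intro subspace_add) auto
    then show ?thesis
      by (simp add: algebra_simps)
  qed
  have "y * a * x - 1 \<in> Ap"
    using x y by (intro one[of Ap "y * a" x] subspace_Ap mult_Ap) (auto simp: proj_plus_compl_eq_iff)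
  moreover have "y * (a * x) - 1 \<in> Am"
    using x y by (intro one[of Am y "a * x"] subspace_Am mult_Am) (auto simp: proj_plus_compl_eq_iff)
  ultimately have "y * a * x - 1 = 0"
    by (intro both_imp_zero) (simp_all add: mult.assoc)
  then show ?thesis
    by simp
qed

lemma inverses_of_solutions:
  assumes one_sided: "\<And>u v :: 'a. u * v = 1 \<Longrightarrow> u \<in> GL \<and> v \<in> GL"
    and x: "proj (a * x) + compl x = 1" and y: "proj y + compl (y * a) = 1"
  shows "y * a * x = 1" "x * (y * a) = 1" "y * (a * x) = 1" "a * x * y = 1"
proof -
  show yax: "y * a * x = 1" "y * (a * x) = 1"
    using mult_of_solutions_eq_one[OF x y] by (simp_all add: mult.assoc)
  show "x * (y * a) = 1" "a * x * y = 1"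
    using one_sided yax by (blast intro: GL_right_inverse_commute)+
qed

lemma canonical_factorization_of_solutions:
  assumes one_sided: "\<And>u v :: 'a. u * v = 1 \<Longrightarrow> u \<in> GL \<and> v \<in> GL"
    and x: "proj (a * x) + compl x = 1" and y: "proj y + compl (y * a) = 1"
  shows "x \<in> GL \<and> y \<in> GL \<and> canonical_factorization Ap Am a (inv_elem y) (inv_elem x)"
proof -
  note inverses = inverses_of_solutions[OF one_sided x y]
  have GL: "x \<in> GL" "y \<in> GL" "y * a \<in> GL" "a * x \<in> GL"
    using one_sided inverses by blast+
  have inv: "inv_elem x = y * a" "inv_elem y = a * x" "inv_elem (y * a) = x" "inv_elem (a * x) = y"
    using inverses by (auto intro: inv_elem_eqI)
  have "a * (x * y) = 1" "x * y * a = 1"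
    using inverses by (simp_all add: mult.assoc)
  then have "a \<in> GL"
    unfolding GL_def by blast
  moreover have "a = a * x * (y * a)"
    using inverses(4) by (simp flip: mult.assoc)
  ultimately have "canonical_factorization Ap Am a (a * x) (y * a)"
    using GL x y by (simp add: canonical_factorization_def inv proj_plus_compl_eq_iff)
  then show ?thesis
    using GL inv by simp
qed

end


section \<open>Canonical factorization near the unit\<close>

theorem theorem6p2:
  fixes scl :: "'k::real_normed_field \<Rightarrow> 'a::{ring, monoid_mult} \<Rightarrow> 'a"
    and I :: "'i set"
    and X :: "'i \<Rightarrow> 'a set"
    and nrm :: "'i \<Rightarrow> 'a \<Rightarrow> real"
    and h :: "'i \<Rightarrow> 'i"
    and C :: "'i \<Rightarrow> 'i \<Rightarrow> real"
    and Ap Am :: "'a set"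
    and P Q :: "'a \<Rightarrow> 'a"
    and a :: 'a
    and \<alpha> \<beta> :: 'i
  assumes "decomposing_strong_algebra scl I X nrm h C Ap Am"
    and one_sided: "\<And>u v :: 'a. u * v = 1 \<Longrightarrow> u \<in> GL \<and> v \<in> GL"
    and P_def: "P = proj_along Ap Am"
    and Q_def: "Q = (\<lambda>x. x - P x)"
    and "\<alpha> \<in> I" and "\<beta> \<in> I" and "X (h \<alpha>) \<subseteq> X \<beta>"
    and "1 - a \<in> X \<alpha>" and "1 - a \<in> X \<beta>"
    and "ereal (C \<beta> \<alpha> * nrm \<alpha> (1 - a)) <
           inverse (max (op_norm (X \<beta>) (nrm \<beta>) (X \<beta>) (nrm \<beta>) P)
                        (op_norm (X \<beta>) (nrm \<beta>) (X \<beta>) (nrm \<beta>) Q))"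
  shows "admits_canonical_factorization Ap Am a \<and>
         (\<exists>!x. P (a * x) + Q x = 1) \<and>
         (\<exists>!y. P y + Q (y * a) = 1) \<and>
         (\<forall>x y. P (a * x) + Q x = 1 \<longrightarrow> P y + Q (y * a) = 1 \<longrightarrow>
            x \<in> GL \<and> y \<in> GL \<and>
            canonical_factorization Ap Am a (inv_elem y) (inv_elem x))"
proof -
  interpret decomposing_strong_algebra scl I X nrm h C Ap Am by fact
  have PQ: "P = proj" "Q = (\<lambda>x. compl x)"
    using P_def Q_def by auto
  let ?m = "max (op_norm (X \<beta>) (nrm \<beta>) (X \<beta>) (nrm \<beta>) P) (op_norm (X \<beta>) (nrm \<beta>) (X \<beta>) (nrm \<beta>) Q)"
  have ex_x: "\<exists>x. P (a * x) + Q x = 1"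
    unfolding PQ using assms(5-10) by (intro left_equation_solvable[where m = ?m]) (auto simp: PQ)
  have ex_y: "\<exists>y. P y + Q (y * a) = 1"
    unfolding PQ using assms(5-10) by (intro right_equation_solvable[where m = ?m]) (auto simp: PQ)
  have inverses: "x * (y * a) = 1" "y * a * x = 1" "y * (a * x) = 1" "a * x * y = 1"
    if "P (a * x) + Q x = 1" "P y + Q (y * a) = 1" for x y
    using inverses_of_solutions[OF one_sided, of a x y] that unfolding PQ by blast+
  have "x = x'" if "P (a * x) + Q x = 1" "P (a * x') + Q x' = 1" for x x'
  proof -
    obtain y where "P y + Q (y * a) = 1"
      using ex_y by blast
    then have "x * (y * a) = 1" "y * a * x' = 1"
      using inverses(1,2) that by blast+
    then show ?thesis
      by (metis mult.assoc mult_1_left mult_1_right)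
  qed
  moreover have "y = y'" if "P y + Q (y * a) = 1" "P y' + Q (y' * a) = 1" for y y'
  proof -
    obtain x where "P (a * x) + Q x = 1"
      using ex_x by blast
    then have "y * (a * x) = 1" "a * x * y' = 1"
      using inverses(3,4) that by blast+
    then show ?thesis
      by (metis mult.assoc mult_1_left mult_1_right)
  qed
  moreover have "x \<in> GL \<and> y \<in> GL \<and> canonical_factorization Ap Am a (inv_elem y) (inv_elem x)"
    if "P (a * x) + Q x = 1" "P y + Q (y * a) = 1" for x y
    using canonical_factorization_of_solutions[OF one_sided, of a x y] that unfolding PQ by blast
  ultimately show ?thesis
    using ex_x ex_y unfolding admits_canonical_factorization_def by blast
qed

end
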